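(* Let $|\phi\rangle = A|20\rangle + B|11\rangle + C|02\rangle$ with $A,B,C\in\mathbb{C}$, $|A|^2+|B|^2+|C|^2=1$, be an arbitrary normalized two-photon two-mode state. Then there exists a unitary matrix $M\in \mathrm{U}(3)$ such that the associated three-mode linear optical passive transformation $U$ (acting on modes $1,2$ and one ancillary mode $3$), applied to $|11\rangle_{12}|0\rangle_3$ and followed by post-selection on the vacuum in mode $3$, yields $|\phi\rangle$ with nonzero probability; that is, writing $U|11\rangle|0\rangle=|\phi_0\rangle|0\rangle+|\phi_1\rangle|1\rangle+|\phi_2\rangle|2\rangle$ (the second factor being mode $3$), the vector $|\phi_0\rangle$ is a nonzero scalar multiple of $|\phi\rangle$.
   Context: Consider $N$ bosonic modes with annihilation and creation operators $a_i,a_i^\dagger$, $[a_i,a_j^\dagger]=\delta_{ij}\mathbb{I}$, $[a_i,a_j]=0$, acting on the $N$-mode Fock space with vacuum $|0\cdots0\rangle$. The number states are $|n_1\cdots n_N\rangle=\prod_i (a_i^\dagger)^{n_i}/\sqrt{n_i!}\,|0\cdots 0\rangle$. The linear optical passive (LOP) transformation associated with $M\in\mathrm{U}(N)$ is the unitary operator $U$ on Fock space with $U^\dagger a_iU=\sum_j M_{ij}a_j$ and $U|0\cdots0\rangle=|0\cdots0\rangle$. In particular, for $N=3$, $U|110\rangle=\sum_{p,q=1}^3 M_{p1}M_{q2}\,a_p^\dagger a_q^\dagger|000\rangle$. Post-selection on the vacuum in mode $3$ means projecting the state onto $|0\rangle$ in mode $3$; the probability of success is $\langle\phi_0|\phi_0\rangle$.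 *)

theory Defs
  imports "HOL-Analysis.Analysis"
begin

text \<open>
  The N-mode Fock space is realised in the occupation-number representation as the Hilbert
  space of square-summable families of amplitudes indexed by occupation vectors, with N the
  cardinality of the finite index type of modes.  A state is a function assigning to each
  occupation vector n its amplitude on the number state of n.
\<close>

type_synonym 'n amplitudes = "nat ^ 'n \<Rightarrow> complex"

definition fock :: "'n::finite amplitudes set" where
  "fock = {\<psi>. (\<lambda>n. (cmod (\<psi> n))\<^sup>2) summable_on UNIV}"

text \<open>Conjugate-linear in the first argument.\<close>

definition fock_inner :: "'n::finite amplitudes \<Rightarrow> 'n amplitudes \<Rightarrow> complex" where
  "fock_inner \<phi> \<psi> = (\<Sum>\<^sub>\<infinity>n. cnj (\<phi> n) * \<psi> n)"

definition ket :: "nat ^ 'n::finite \<Rightarrow> 'n amplitudes" where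
  "ket m = (\<lambda>n. if n = m then 1 else 0)"

definition annih :: "'n::finite \<Rightarrow> 'n amplitudes \<Rightarrow> 'n amplitudes" where
  "annih i \<psi> = (\<lambda>n. complex_of_real (sqrt (real (n $ i + 1))) * \<psi> (n + axis i 1))"

text \<open>When the i-th entry of n is 0 the subtraction truncates, but the prefactor vanishes.\<close>

definition creat :: "'n::finite \<Rightarrow> 'n amplitudes \<Rightarrow> 'n amplitudes" where
  "creat i \<psi> = (\<lambda>n. complex_of_real (sqrt (real (n $ i))) * \<psi> (n - axis i 1))"

text \<open>
  The following facts identify the number states with those generated from the vacuum by the
  creation operators, and confirm the canonical commutation relations.
\<close>

lemma annih_vacuum: "annih (i :: 'n::finite) (ket 0) = (\<lambda>n. 0)"
proof
  fix n :: "nat ^ 'n"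
  have "(n + axis i 1) $ i \<noteq> 0 $ i"
    by simp
  then have "n + axis i 1 \<noteq> 0"
    by metis
  then show "annih i (ket 0) n = 0"
    by (simp add: annih_def ket_def)
qed

lemma creat_ket:
  "creat (i :: 'n::finite) (ket m) = (\<lambda>n. complex_of_real (sqrt (real (m $ i + 1))) * ket (m + axis i 1) n)"
proof
  fix n :: "nat ^ 'n"
  show "creat i (ket m) n = complex_of_real (sqrt (real (m $ i + 1))) * ket (m + axis i 1) n"
  proof (cases "n = m + axis i 1")
    case True
    then show ?thesis
      by (simp add: creat_def ket_def)
  next
    case False
    have "n $ i = 0" if "n - axis i 1 = m"
    proof (rule ccontr)
      assume "n $ i \<noteq> 0"
      then have "n $ k = (m + axis i 1) $ k" for k
        by (cases "k = i") (simp_all flip: that add: axis_def)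
      then have "n = m + axis i 1"
        by (simp add: vec_eq_iff)
      with False show "False" ..
    qed
    with False show ?thesis
      by (auto simp: creat_def ket_def)
  qed
qed

lemma creat_scale: "creat i (\<lambda>m. c * \<psi> m) = (\<lambda>m. c * creat i \<psi> m)"
  by (simp add: creat_def fun_eq_iff)

lemma creat_funpow_ket:
  fixes i :: "'n::finite"
  assumes "n $ i = 0"
  shows "(creat i ^^ k) (\<lambda>m. c * ket n m) =
    (\<lambda>m. c * complex_of_real (sqrt (fact k)) * ket (n + axis i k) m)"
proof (induction k)
  case 0
  have unshift: "n + axis i 0 = n"
    by (simp add: vec_eq_iff axis_def)
  show ?case
    unfolding unshift by simp
next
  case (Suc k)
  have shift: "n + axis i k + axis i 1 = n + axis i (Suc k)"
    by (simp add: vec_eq_iff axis_def)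
  have factor: "sqrt (fact (Suc k)) = sqrt (fact k) * sqrt (real (k + 1))"
    by (simp add: mult.commute flip: real_sqrt_mult)
  have entry: "(n + axis i k) $ i = k"
    using assms by simp
  show ?case
    unfolding funpow.simps comp_def Suc creat_scale creat_ket shift factor entry
    by (simp add: fun_eq_iff algebra_simps)
qed

lemma ket_eq_creat_product:
  assumes "distinct is" "set is = (UNIV :: 'n::finite set)"
  shows "foldr (\<lambda>i. creat i ^^ (n $ i)) is (ket 0) =
    (\<lambda>m. complex_of_real (sqrt (\<Prod>i\<in>UNIV. fact (n $ i))) * ket n m)"
proof -
  have "foldr (\<lambda>i. creat i ^^ (n $ i)) is (ket 0) =
      (\<lambda>m. complex_of_real (sqrt (\<Prod>i\<in>set is. fact (n $ i))) *
        ket (\<chi> i. if i \<in> set is then n $ i else 0) m)"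
    using assms(1)
  proof (induction "is")
    case Nil
    have "(\<chi> i. 0) = (0 :: nat ^ 'n)"
      by (simp add: vec_eq_iff)
    then show ?case
      by simp
  next
    case (Cons i js)
    have zero: "(\<chi> k. if k \<in> set js then n $ k else 0) $ i = 0"
      using Cons.prems by simp
    have add: "(\<chi> k. if k \<in> set js then n $ k else 0) + axis i (n $ i) =
        (\<chi> k. if k \<in> set (i # js) then n $ k else 0)"
      using Cons.prems by (auto simp: vec_eq_iff axis_def)
    have IH: "foldr (\<lambda>i. creat i ^^ (n $ i)) js (ket 0) =
        (\<lambda>m. complex_of_real (sqrt (\<Prod>i\<in>set js. fact (n $ i))) *
          ket (\<chi> i. if i \<in> set js then n $ i else 0) m)"
      using Cons by simp
    have factor: "sqrt (\<Prod>k\<in>set (i # js). fact (n $ k)) =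
        sqrt (\<Prod>k\<in>set js. fact (n $ k)) * sqrt (fact (n $ i))"
      using Cons.prems by (simp add: real_sqrt_mult mult.commute)
    show ?case
      unfolding foldr.simps comp_def IH creat_funpow_ket[OF zero] add factor of_real_mult ..
  qed
  then show ?thesis
    using assms(2) by simp
qed

lemma annih_annih_commute: "annih (i :: 'n::finite) (annih j \<psi>) = annih j (annih i \<psi>)"
proof (cases "i = j")
  case False
  have "n + axis i 1 + axis j 1 = n + axis j 1 + axis i 1" for n :: "nat ^ 'n"
    by (simp add: ac_simps)
  with False show ?thesis
    by (simp add: annih_def fun_eq_iff axis_def)
qed simp

lemma canonical_commutation:
  "annih i (creat j \<psi>) n - creat j (annih i \<psi>) n = (if i = j then \<psi> n else 0)"
proof (cases "i = j")
  case True
  have undo: "n + axis j 1 - axis j 1 = n"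
    by (simp add: vec_eq_iff)
  have square: "complex_of_real (sqrt x) * (complex_of_real (sqrt x) * z) = of_real x * z"
    if "x \<ge> 0" for x z
    using that by (simp flip: mult.assoc of_real_mult)
  show ?thesis
  proof (cases "n $ j = 0")
    case True
    with \<open>i = j\<close> undo show ?thesis
      by (simp add: annih_def creat_def)
  next
    case False
    have redo: "n - axis j 1 + axis j 1 = n"
      using False by (auto simp: vec_eq_iff axis_def)
    have pred: "(n - axis j 1) $ j + 1 = n $ j"
      using False by simp
    have suc: "(n + axis j 1) $ j = n $ j + 1"
      by simp
    show ?thesis
      unfolding annih_def creat_def \<open>i = j\<close> undo redo pred suc
      by (simp only: square of_nat_0_le_iff) (simp add: algebra_simps)
  qed
next
  case False
  show ?thesis
  proof (cases "n $ j = 0")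
    case True
    with False show ?thesis
      by (simp add: annih_def creat_def axis_def)
  next
    case nonzero: False
    have "n + axis i 1 - axis j 1 = n - axis j 1 + axis i 1"
      using False nonzero by (auto simp: vec_eq_iff axis_def)
    with False show ?thesis
      by (simp add: annih_def creat_def axis_def)
  qed
qed

definition fock_operator :: "('n::finite amplitudes \<Rightarrow> 'n amplitudes) \<Rightarrow> bool" where
  "fock_operator T \<longleftrightarrow>
     (\<forall>\<psi>\<in>fock. T \<psi> \<in> fock) \<and>
     (\<forall>\<psi>\<in>fock. \<forall>\<phi>\<in>fock. \<forall>c d.
        T (\<lambda>n. c * \<psi> n + d * \<phi> n) = (\<lambda>n. c * T \<psi> n + d * T \<phi> n))"

definition fock_unitary ::
  "('n::finite amplitudes \<Rightarrow> 'n amplitudes) \<Rightarrow> ('n amplitudes \<Rightarrow> 'n amplitudes) \<Rightarrow> bool" where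
  "fock_unitary U Ud \<longleftrightarrow>
     fock_operator U \<and> fock_operator Ud \<and>
     (\<forall>\<phi>\<in>fock. \<forall>\<psi>\<in>fock. fock_inner \<phi> (U \<psi>) = fock_inner (Ud \<phi>) \<psi>) \<and>
     (\<forall>\<psi>\<in>fock. Ud (U \<psi>) = \<psi> \<and> U (Ud \<psi>) = \<psi>)"

definition annih_domain :: "'n::finite \<Rightarrow> 'n amplitudes set" where
  "annih_domain i = {\<psi> \<in> fock. annih i \<psi> \<in> fock}"

definition unitary_matrix :: "complex ^ 'n::finite ^ 'n \<Rightarrow> bool" where
  "unitary_matrix M \<longleftrightarrow>
     (let Md = transpose (\<chi> i j. cnj (M $ i $ j)) in Md ** M = mat 1 \<and> M ** Md = mat 1)"

text \<open>
  The annihilation operators are unbounded, so the operator identity for the conjugated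
  annihilation operators is required on the common domain of all of them; there both sides are
  well-defined vectors of the Fock space.  Ud is the adjoint of U.
\<close>

definition lop_transformation ::
  "complex ^ 'n::finite ^ 'n \<Rightarrow> ('n amplitudes \<Rightarrow> 'n amplitudes) \<Rightarrow> bool" where
  "lop_transformation M U \<longleftrightarrow>
     U (ket 0) = ket 0 \<and>
     (\<exists>Ud. fock_unitary U Ud \<and>
        (\<forall>i. \<forall>\<psi>\<in>(\<Inter>j. annih_domain j).
           U \<psi> \<in> annih_domain i \<and>
           Ud (annih i (U \<psi>)) = (\<lambda>n. \<Sum>j\<in>UNIV. M $ i $ j * annih j \<psi> n)))"

text \<open>Modes 1, 2 carry the first factor and mode 3 carries the second.\<close>

definition tensor_2_1 :: "2 amplitudes \<Rightarrow> 1 amplitudes \<Rightarrow> 3 amplitudes" where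
  "tensor_2_1 \<psi> \<eta> = (\<lambda>n. \<psi> (vector [n $ 1, n $ 2]) * \<eta> (vector [n $ 3]))"

end

theory Submission
  imports Defs
begin

text \<open>
  Applying \<open>U\<close> to \<open>a\<^sub>1\<^sup>\<dagger>a\<^sub>2\<^sup>\<dagger>|0\<rangle>\<close> and projecting onto the vacuum of mode 3 gives the product of two
  linear forms in \<open>a\<^sub>1\<^sup>\<dagger>, a\<^sub>2\<^sup>\<dagger>\<close>, read off the first two columns of \<open>M\<close>.  Over the complex numbers
  every binary quadratic form is such a product; rescaling the two forms makes their coefficient
  matrix a contraction with largest singular value 1, which one ancillary mode dilates to a unitary.

  For the existence of \<open>U\<close>, amplitudes are determined by the annihilation operators and the vacuum
  amplitude, so \<open>a\<^sub>iU = U(\<Sum>\<^sub>jM\<^sub>i\<^sub>ja\<^sub>j)\<close> and \<open>\<langle>0|U\<psi>\<rangle> = \<langle>0|\<psi>\<rangle>\<close> define \<open>U\<close> uniquely.  It is an isometry on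
  each particle-number sector by induction on the particle number \<open>k\<close>, since
  \<open>\<Sum>\<^sub>i\<langle>a\<^sub>i\<phi>|a\<^sub>i\<psi>\<rangle> = (k+1)\<langle>\<phi>|\<psi>\<rangle>\<close> on the sector of \<open>k+1\<close> particles.
\<close>

section \<open>Second quantization of a matrix\<close>

lemma sum_add_axis: "(\<Sum>j\<in>UNIV. (m + axis (i::'n::finite) 1) $ j) = Suc (\<Sum>j\<in>UNIV. m $ j)"
  by (simp add: sum.distrib axis_def)

text \<open>A nonzero occupation vector has a mode that can be lowered, so induction on the total
  photon number reaches 0. This form fits \<open>annih\<close>, which links the amplitudes at
  \<open>m\<close> and \<open>m + axis i 1\<close>.\<close>

lemma occupation_induct [case_names zero add]:
  fixes m :: "nat ^ 'n::finite"
  assumes "P 0" and "\<And>m i. P m \<Longrightarrow> P (m + axis i 1)"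
  shows "P m"
proof (induction "\<Sum>i\<in>UNIV. m $ i" arbitrary: m)
  case 0
  then have "m = 0"
    by (simp add: vec_eq_iff)
  with assms(1) show ?case
    by simp
next
  case (Suc k)
  then obtain i where i: "m $ i \<noteq> 0"
    by (metis Zero_not_Suc sum.neutral)
  have m: "m = (m - axis i 1) + axis i 1"
    using i by (auto simp: vec_eq_iff axis_def)
  have "k = (\<Sum>j\<in>UNIV. (m - axis i 1) $ j)"
    using Suc.hyps(2) sum_add_axis[of "m - axis i 1" i] unfolding m[symmetric] by simp
  then have "P (m - axis i 1)"
    by (rule Suc.hyps(1))
  then show ?case
    using assms(2) m by metis
qed

text \<open>The prefactor in \<open>annih\<close> never vanishes, so the lowered amplitudes
  determine every value except the one at 0.\<close>

lemma amplitudes_eqI: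
  assumes "f 0 = g 0" and "\<And>i n. annih i f n = annih i g n"
  shows "f = g"
proof
  fix m show "f m = g m"
  proof (induction m rule: occupation_induct)
    case (add m i)
    show ?case
      using assms(2)[of i m] by (simp add: annih_def del: of_nat_Suc)
  qed (rule assms(1))
qed

section \<open>Mixed annihilation operators\<close>

lemma annih_linear:
  "annih i (\<lambda>n. c * \<psi> n + d * \<phi> n) = (\<lambda>n. c * annih i \<psi> n + d * annih i \<phi> n)"
  by (simp add: annih_def fun_eq_iff algebra_simps)

lemma annih_sum:
  "annih i (\<lambda>n. \<Sum>j\<in>S. c j * \<psi> j n) = (\<lambda>n. \<Sum>j\<in>S. c j * annih i (\<psi> j) n)"
  by (simp add: annih_def fun_eq_iff sum_distrib_left algebra_simps)

text \<open>The operator b_i that conjugating a_i by the transformation has to produce.\<close>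

definition mix_annih ::
  "complex ^ 'n ^ 'n \<Rightarrow> 'n::finite \<Rightarrow> 'n amplitudes \<Rightarrow> 'n amplitudes" where
  "mix_annih M i \<psi> = (\<lambda>n. \<Sum>j\<in>UNIV. M $ i $ j * annih j \<psi> n)"

lemma mix_annih_linear:
  "mix_annih M i (\<lambda>n. c * \<psi> n + d * \<phi> n) = (\<lambda>n. c * mix_annih M i \<psi> n + d * mix_annih M i \<phi> n)"
  by (simp add: mix_annih_def annih_linear fun_eq_iff sum_distrib_left algebra_simps sum.distrib)

text \<open>Both sides are the same combination of products a_k a_l, and these commute. Hence
  products of powers of the b_i do not depend on the order of the modes, as
  \<open>Finite_Set.fold\<close> requires.\<close>

lemma mix_annih_commute: "mix_annih M i (mix_annih M j \<psi>) = mix_annih M j (mix_annih M i \<psi>)"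
proof -
  have "mix_annih M i (mix_annih M j \<psi>) n =
      (\<Sum>k\<in>UNIV. \<Sum>l\<in>UNIV. M $ i $ k * (M $ j $ l * annih k (annih l \<psi>) n))" for i j n
    by (simp add: mix_annih_def annih_sum sum_distrib_left)
  note expand = this
  show ?thesis
    unfolding fun_eq_iff expand
    by (subst sum.swap) (simp add: annih_annih_commute algebra_simps)
qed

lemma mix_annih_matrix_mult:
  "mix_annih (M ** M') i \<psi> = (\<lambda>n. \<Sum>j\<in>UNIV. M $ i $ j * mix_annih M' j \<psi> n)"
proof
  fix n
  show "mix_annih (M ** M') i \<psi> n = (\<Sum>j\<in>UNIV. M $ i $ j * mix_annih M' j \<psi> n)"
    unfolding mix_annih_def matrix_matrix_mult_def vec_lambda_beta sum_distrib_left sum_distrib_right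
    by (subst sum.swap) (simp add: mult.assoc)
qed

lemma mix_annih_one: "mix_annih (mat 1) i \<psi> = annih i \<psi>"
  by (simp add: mix_annih_def mat_def fun_eq_iff if_distrib if_distribR cong: if_cong)

text \<open>
  The defining relations force \<open>\<langle>m|U\<psi>\<rangle> = \<langle>0|a\<^sup>mU\<psi>\<rangle>/sqrt m! = \<langle>0|U b\<^sup>m\<psi>\<rangle>/sqrt m!\<close> with
  \<open>b\<^sub>i = \<Sum>\<^sub>j M\<^sub>i\<^sub>j a\<^sub>j\<close>, and \<open>U\<close> fixes the vacuum.  The right-hand side makes sense for arbitrary,
  not necessarily square-summable, amplitudes.
\<close>

definition second_quantization ::
  "complex ^ 'n ^ 'n \<Rightarrow> 'n::finite amplitudes \<Rightarrow> 'n amplitudes" where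
  "second_quantization M \<psi> = (\<lambda>m. Finite_Set.fold (\<lambda>i. mix_annih M i ^^ (m $ i)) \<psi> UNIV 0 /
     complex_of_real (sqrt (\<Prod>i\<in>UNIV. fact (m $ i))))"

lemma comp_fun_commute_mix_annih: "comp_fun_commute (\<lambda>i. mix_annih M i ^^ (p i))"
proof -
  interpret comp_fun_commute "mix_annih M"
    by standard (simp add: fun_eq_iff mix_annih_commute[of M])
  show ?thesis
    by (rule comp_fun_commute_funpow)
qed

text \<open>Raising the exponent of mode i puts one more factor b_i outside the product; since the
  b_k commute, it can be moved inside to act on \<psi> first. This is what turns a_i U into U
  b_i.\<close>

lemma fold_mix_annih_add_axis:
  fixes m :: "nat ^ 'n::finite"
  shows "Finite_Set.fold (\<lambda>k. mix_annih M k ^^ ((m + axis i 1) $ k)) \<psi> UNIV =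
    Finite_Set.fold (\<lambda>k. mix_annih M k ^^ (m $ k)) (mix_annih M i \<psi>) UNIV"
proof -
  interpret f: comp_fun_commute "\<lambda>k. mix_annih M k ^^ (m $ k)"
    by (rule comp_fun_commute_mix_annih)
  interpret f': comp_fun_commute "\<lambda>k. mix_annih M k ^^ ((m + axis i 1) $ k)"
    by (rule comp_fun_commute_mix_annih)
  have U: "UNIV = insert i (UNIV - {i})"
    by auto
  have cong: "Finite_Set.fold (\<lambda>k. mix_annih M k ^^ ((m + axis i 1) $ k)) \<psi> (UNIV - {i}) =
      Finite_Set.fold (\<lambda>k. mix_annih M k ^^ (m $ k)) \<psi> (UNIV - {i})"
    by (rule Finite_Set.fold_cong[of UNIV])
      (auto simp: axis_def simp flip: comp_fun_commute_def' intro: comp_fun_commute_mix_annih)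
  have out: "mix_annih M i (Finite_Set.fold (\<lambda>k. mix_annih M k ^^ (m $ k)) \<psi> A) =
      Finite_Set.fold (\<lambda>k. mix_annih M k ^^ (m $ k)) (mix_annih M i \<psi>) A" for A
  proof (induction A rule: infinite_finite_induct)
    case (insert x A)
    have "mix_annih M i ((mix_annih M x ^^ k) \<xi>) = (mix_annih M x ^^ k) (mix_annih M i \<xi>)" for k \<xi>
      by (induction k) (simp_all add: mix_annih_commute[of M i])
    with insert show ?case
      by simp
  qed simp_all
  have "Finite_Set.fold (\<lambda>k. mix_annih M k ^^ ((m + axis i 1) $ k)) \<psi> UNIV =
      mix_annih M i ((mix_annih M i ^^ (m $ i))
        (Finite_Set.fold (\<lambda>k. mix_annih M k ^^ (m $ k)) \<psi> (UNIV - {i})))"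
    by (subst U, subst f'.fold_insert) (use cong in \<open>simp_all\<close>)
  also have "\<dots> = mix_annih M i (Finite_Set.fold (\<lambda>k. mix_annih M k ^^ (m $ k)) \<psi> UNIV)"
    by (subst (2) U, subst f.fold_insert) simp_all
  finally show ?thesis
    by (simp add: out)
qed

lemma second_quantization_zero: "second_quantization M \<psi> 0 = \<psi> 0"
proof -
  have "Finite_Set.fold (\<lambda>i. mix_annih M i ^^ 0) \<psi> A = \<psi>" for A
  proof (induction A rule: infinite_finite_induct)
    case (insert x A)
    interpret comp_fun_commute "\<lambda>k. mix_annih M k ^^ 0"
      by (rule comp_fun_commute_mix_annih)
    show ?case
      using fold_insert[OF insert.hyps] insert.IH by (simp add: id_def)
  qed simp_all
  then show ?thesis
    by (simp add: second_quantization_def)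
qed

text \<open>Once the extra b_i acts on \<psi>, only normalisations remain: the product of factorials
  grows by \<open>m $ i + 1\<close>, whose root cancels the prefactor of
  \<open>annih\<close>.\<close>

lemma annih_second_quantization:
  "annih i (second_quantization M \<psi>) = second_quantization M (mix_annih M i \<psi>)"
proof
  fix m
  have "(\<Prod>k\<in>UNIV. fact ((m + axis i 1) $ k)) =
      real (m $ i + 1) * (\<Prod>k\<in>UNIV. fact (m $ k))"
    by (subst (1 2) prod.remove[of UNIV i]) (auto simp: axis_def intro!: prod.cong)
  then have sqrt: "sqrt (\<Prod>k\<in>UNIV. fact ((m + axis i 1) $ k)) =
      sqrt (real (m $ i + 1)) * sqrt (\<Prod>k\<in>UNIV. fact (m $ k))"
    by (simp only: real_sqrt_mult)
  have nz: "complex_of_real (sqrt (real (m $ i + 1))) \<noteq> 0"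
    by (simp del: of_nat_Suc)
  show "annih i (second_quantization M \<psi>) m = second_quantization M (mix_annih M i \<psi>) m"
    unfolding annih_def second_quantization_def fold_mix_annih_add_axis sqrt of_real_mult
    using nz by simp
qed

lemma second_quantization_linear:
  "second_quantization M (\<lambda>n. c * \<psi> n + d * \<phi> n) =
    (\<lambda>n. c * second_quantization M \<psi> n + d * second_quantization M \<phi> n)"
proof
  fix m
  show "second_quantization M (\<lambda>n. c * \<psi> n + d * \<phi> n) m =
    c * second_quantization M \<psi> m + d * second_quantization M \<phi> m"
  proof (induction m arbitrary: \<psi> \<phi> rule: occupation_induct)
    case (add m i)
    let ?U = "second_quantization M"
    let ?r = "complex_of_real (sqrt (real (m $ i + 1)))"
    have "?r * ?U (\<lambda>n. c * \<psi> n + d * \<phi> n) (m + axis i 1) = annih i (?U (\<lambda>n. c * \<psi> n + d * \<phi> n)) m"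
      by (simp add: annih_def)
    also have "\<dots> = c * annih i (?U \<psi>) m + d * annih i (?U \<phi>) m"
      unfolding annih_second_quantization mix_annih_linear by (rule add)
    also have "\<dots> = ?r * (c * ?U \<psi> (m + axis i 1) + d * ?U \<phi> (m + axis i 1))"
      by (simp add: annih_def algebra_simps)
    finally show ?case
      by (simp del: of_nat_Suc)
  qed (simp add: second_quantization_zero)
qed

lemma second_quantization_sum:
  "second_quantization M (\<lambda>n. \<Sum>j\<in>S. c j * \<psi> j n) = (\<lambda>n. \<Sum>j\<in>S. c j * second_quantization M (\<psi> j) n)"
proof (induction S rule: infinite_finite_induct)
  case (insert x S)
  then show ?case
    using second_quantization_linear[of M "c x" "\<psi> x" 1 "\<lambda>n. \<Sum>j\<in>S. c j * \<psi> j n"] by simp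
qed (use second_quantization_linear[of M 0 "\<lambda>n. 0" 0 "\<lambda>n. 0"] in simp_all)

text \<open>Induction on the occupation vector with \<psi> varying, because each lowering replaces
  \<psi> by \<open>mix_annih M i \<psi>\<close>. It serves to identify the second quantizations of
  the identity and of products.\<close>

lemma second_quantization_unique:
  assumes "\<And>\<psi>. T \<psi> 0 = \<psi> 0" and "\<And>\<psi> i. annih i (T \<psi>) = T (mix_annih M i \<psi>)"
  shows "T \<psi> = second_quantization M \<psi>"
proof
  fix m show "T \<psi> m = second_quantization M \<psi> m"
  proof (induction m arbitrary: \<psi> rule: occupation_induct)
    case (add m i)
    have "annih i (T \<psi>) m = annih i (second_quantization M \<psi>) m"
      unfolding assms(2) annih_second_quantization by (rule add)
    then show ?case
      by (simp add: annih_def del: of_nat_Suc)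
  qed (simp add: assms(1) second_quantization_zero)
qed

lemma second_quantization_one: "second_quantization (mat 1) \<psi> = \<psi>"
  by (rule second_quantization_unique[symmetric, of "\<lambda>\<psi>. \<psi>"]) (simp_all add: mix_annih_one)

text \<open>Lowering the composite mixes by \<open>M\<close> outside and by \<open>M'\<close>
  inside, which together is mixing by \<open>M ** M'\<close>; uniqueness does the rest.\<close>

lemma second_quantization_mult:
  "second_quantization M (second_quantization M' \<psi>) = second_quantization (M ** M') \<psi>"
proof (rule second_quantization_unique)
  fix \<psi> i
  have "annih i (second_quantization M (second_quantization M' \<psi>)) =
      second_quantization M (\<lambda>n. \<Sum>j\<in>UNIV. M $ i $ j * second_quantization M' (mix_annih M' j \<psi>) n)"
    by (simp add: annih_second_quantization mix_annih_def[of M])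
  also have "\<dots> = second_quantization M (second_quantization M' (mix_annih (M ** M') i \<psi>))"
    by (simp add: second_quantization_sum mix_annih_matrix_mult)
  finally show "annih i (second_quantization M (second_quantization M' \<psi>)) = \<dots>" .
qed (simp add: second_quantization_zero)

lemma second_quantization_vacuum: "second_quantization M (ket 0) = ket 0"
proof (rule amplitudes_eqI)
  have "mix_annih M i (ket 0) = (\<lambda>n. 0)" for i
    by (simp add: mix_annih_def annih_vacuum)
  moreover have "second_quantization M (\<lambda>n. 0) = (\<lambda>n. 0)"
    using second_quantization_sum[of M _ _ "{}"] by simp
  ultimately show "annih i (second_quantization M (ket 0)) n = annih i (ket 0) n" for i n
    by (simp add: annih_second_quantization annih_vacuum)
qed (simp add: second_quantization_zero)

section \<open>Unitarity\<close>

definition sector :: "nat \<Rightarrow> (nat ^ 'n::finite) set" where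
  "sector k = {n. (\<Sum>i\<in>UNIV. n $ i) = k}"

lemma finite_sector: "finite (sector k :: (nat ^ 'n::finite) set)"
proof (rule finite_subset)
  have "n = vec_lambda (\<lambda>i. n $ i) \<and> (\<lambda>i. n $ i) \<in> (\<Pi>\<^sub>E i\<in>UNIV. {..k})" if "n \<in> sector k" for n :: "nat ^ 'n"
    using that by (auto simp: sector_def intro: member_le_sum)
  then show "sector k \<subseteq> vec_lambda ` (\<Pi>\<^sub>E i\<in>(UNIV :: 'n set). {..k})"
    by blast
  show "finite (vec_lambda ` (\<Pi>\<^sub>E i\<in>(UNIV :: 'n set). {..k}))"
    by (simp add: finite_PiE)
qed

text \<open>The adjoint of a_i times a_i counts the photons in mode i. The shift by
  \<open>axis i 1\<close> maps the sector bijectively onto those vectors of the next one whose i-th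
  entry is nonzero; the remaining vectors carry weight 0.\<close>

lemma sector_inner_annih:
  fixes \<phi> \<psi> :: "'n::finite amplitudes"
  shows "(\<Sum>n\<in>sector k. cnj (annih i \<phi> n) * annih i \<psi> n) =
    (\<Sum>n\<in>sector (Suc k). of_nat (n $ i) * (cnj (\<phi> n) * \<psi> n))"
proof -
  have square: "complex_of_real (sqrt x) * complex_of_real (sqrt x) = of_real x" if "x \<ge> 0" for x
    using that by (simp flip: of_real_mult)
  have "cnj (annih i \<phi> n) * annih i \<psi> n =
      of_nat (n $ i + 1) * (cnj (\<phi> (n + axis i 1)) * \<psi> (n + axis i 1))" for n
    using square[of "real (n $ i + 1)"] by (simp add: annih_def algebra_simps)
  then have "(\<Sum>n\<in>sector k. cnj (annih i \<phi> n) * annih i \<psi> n) =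
      (\<Sum>n\<in>sector k. of_nat (n $ i + 1) * (cnj (\<phi> (n + axis i 1)) * \<psi> (n + axis i 1)))"
    by simp
  also have "\<dots> = (\<Sum>n\<in>{n \<in> sector (Suc k). n $ i \<noteq> 0}. of_nat (n $ i) * (cnj (\<phi> n) * \<psi> n))"
  proof (rule sum.reindex_bij_witness[where i = "\<lambda>n. n - axis i 1" and j = "\<lambda>n. n + axis i 1"])
    fix n :: "nat ^ 'n" assume n: "n \<in> {n \<in> sector (Suc k). n $ i \<noteq> 0}"
    then show redo: "n - axis i 1 + axis i 1 = n"
      by (auto simp: vec_eq_iff axis_def)
    show "n - axis i 1 \<in> sector k"
      using n sum_add_axis[of "n - axis i 1" i] unfolding redo by (simp add: sector_def)
  next
    fix n :: "nat ^ 'n" assume "n \<in> sector k"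
    then show "n + axis i 1 \<in> {n \<in> sector (Suc k). n $ i \<noteq> 0}"
      using sum_add_axis[of n i] by (simp add: sector_def)
  qed (simp_all add: vec_eq_iff)
  also have "\<dots> = (\<Sum>n\<in>sector (Suc k). of_nat (n $ i) * (cnj (\<phi> n) * \<psi> n))"
    by (rule sum.mono_neutral_left) (auto simp: finite_sector)
  finally show ?thesis .
qed

text \<open>Summed over the modes, the photon counts give the total photon number, which is constant
  on a sector.\<close>

lemma sum_sector_inner_annih:
  fixes \<phi> \<psi> :: "'n::finite amplitudes"
  shows "(\<Sum>n\<in>sector k. \<Sum>i\<in>UNIV. cnj (annih i \<phi> n) * annih i \<psi> n) =
    of_nat (Suc k) * (\<Sum>n\<in>sector (Suc k). cnj (\<phi> n) * \<psi> n)"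
proof -
  have "(\<Sum>n\<in>sector k. \<Sum>i\<in>UNIV. cnj (annih i \<phi> n) * annih i \<psi> n) =
      (\<Sum>i\<in>UNIV. \<Sum>n\<in>sector (Suc k). of_nat (n $ i) * (cnj (\<phi> n) * \<psi> n))"
    by (subst sum.swap) (simp only: sector_inner_annih)
  also have "\<dots> = (\<Sum>n\<in>sector (Suc k). of_nat (\<Sum>i\<in>UNIV. n $ i) * (cnj (\<phi> n) * \<psi> n))"
    by (subst sum.swap) (simp add: sum_distrib_right)
  also have "\<dots> = (\<Sum>n\<in>sector (Suc k). of_nat (Suc k) * (cnj (\<phi> n) * \<psi> n))"
    by (rule sum.cong) (simp_all add: sector_def del: of_nat_sum of_nat_Suc)
  finally show ?thesis
    by (simp only: sum_distrib_left)
qed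

lemma unitary_matrix_columns:
  assumes "unitary_matrix M"
  shows "(\<Sum>i\<in>UNIV. cnj (M $ i $ j) * M $ i $ k) = (if j = k then 1 else 0)"
proof -
  have "(transpose (\<chi> i j. cnj (M $ i $ j)) ** M) $ j $ k = mat 1 $ j $ k"
    using assms by (simp add: unitary_matrix_def Let_def)
  then show ?thesis
    by (simp add: matrix_matrix_mult_def transpose_def mat_def)
qed

text \<open>At each fixed \<open>n\<close>, the values of the b_i are the image under
  \<open>M\<close> of the vector of values of the a_i, and orthonormal columns preserve inner
  products.\<close>

lemma mix_annih_inner:
  assumes "unitary_matrix M"
  shows "(\<Sum>i\<in>UNIV. cnj (mix_annih M i \<phi> n) * mix_annih M i \<psi> n) =
    (\<Sum>i\<in>UNIV. cnj (annih i \<phi> n) * annih i \<psi> n)"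
proof -
  have "(\<Sum>i\<in>UNIV. cnj (mix_annih M i \<phi> n) * mix_annih M i \<psi> n) =
      (\<Sum>i\<in>UNIV. \<Sum>j\<in>UNIV. \<Sum>k\<in>UNIV.
        cnj (M $ i $ j) * M $ i $ k * (cnj (annih j \<phi> n) * annih k \<psi> n))"
    unfolding mix_annih_def cnj_sum complex_cnj_mult sum_product by (simp only: ac_simps)
  also have "\<dots> = (\<Sum>j\<in>UNIV. \<Sum>k\<in>UNIV.
      (\<Sum>i\<in>UNIV. cnj (M $ i $ j) * M $ i $ k) * (cnj (annih j \<phi> n) * annih k \<psi> n))"
    unfolding sum_distrib_right by (subst sum.swap) (intro sum.cong refl sum.swap)
  also have "\<dots> = (\<Sum>j\<in>UNIV. \<Sum>k\<in>UNIV. if j = k then cnj (annih j \<phi> n) * annih k \<psi> n else 0)"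
    unfolding unitary_matrix_columns[OF assms] by (intro sum.cong) auto
  finally show ?thesis
    by simp
qed

text \<open>Both vectors vary in the induction: the step applies the hypothesis to
  \<open>mix_annih M i \<phi>\<close> and \<open>mix_annih M i \<psi>\<close>, one sector below, and
  cancels \<open>of_nat (Suc k)\<close>.\<close>

lemma sector_inner_second_quantization:
  fixes \<phi> \<psi> :: "'n::finite amplitudes"
  assumes "unitary_matrix M"
  shows "(\<Sum>n\<in>sector k. cnj (second_quantization M \<phi> n) * second_quantization M \<psi> n) =
    (\<Sum>n\<in>sector k. cnj (\<phi> n) * \<psi> n)"
proof (induction k arbitrary: \<phi> \<psi>)
  case 0
  have "sector 0 = {0 :: nat ^ 'n}"
    by (auto simp: sector_def vec_eq_iff)
  then show ?case
    by (simp add: second_quantization_zero)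
next
  case (Suc k)
  let ?U = "second_quantization M"
  have "of_nat (Suc k) * (\<Sum>n\<in>sector (Suc k). cnj (?U \<phi> n) * ?U \<psi> n) =
      (\<Sum>i\<in>UNIV. \<Sum>n\<in>sector k. cnj (?U (mix_annih M i \<phi>) n) * ?U (mix_annih M i \<psi>) n)"
    by (subst sum.swap) (simp only: annih_second_quantization flip: sum_sector_inner_annih)
  also have "\<dots> = (\<Sum>n\<in>sector k. \<Sum>i\<in>UNIV. cnj (mix_annih M i \<phi> n) * mix_annih M i \<psi> n)"
    by (subst sum.swap) (simp only: Suc)
  also have "\<dots> = of_nat (Suc k) * (\<Sum>n\<in>sector (Suc k). cnj (\<phi> n) * \<psi> n)"
    by (simp only: mix_annih_inner[OF assms] sum_sector_inner_annih)
  finally show ?case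
    by (simp del: of_nat_Suc)
qed

section \<open>Square-summability and limits over growing photon number\<close>

definition ball_sector :: "nat \<Rightarrow> (nat ^ 'n::finite) set" where
  "ball_sector K = (\<Union>k\<le>K. sector k)"

lemma finite_ball_sector: "finite (ball_sector K)"
  by (simp add: ball_sector_def finite_sector)

text \<open>The total occupation of all members of \<open>F\<close> serves as bound. Containment for
  every larger \<open>L\<close> is what lets infinite sums be computed as limits along
  \<open>ball_sector\<close>.\<close>

lemma finite_subset_ball_sector:
  assumes "finite F"
  obtains K where "\<And>L. L \<ge> K \<Longrightarrow> F \<subseteq> ball_sector L"
proof
  fix L assume L: "L \<ge> (\<Sum>n\<in>F. \<Sum>i\<in>UNIV. n $ i)"
  have "(\<Sum>i\<in>UNIV. n $ i) \<le> L" if "n \<in> F" for n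
    using member_le_sum[OF that _ assms, of "\<lambda>n. \<Sum>i\<in>UNIV. n $ i"] L by simp
  then show "F \<subseteq> ball_sector L"
    by (auto simp: ball_sector_def sector_def)
qed

lemma ball_sector_inner_second_quantization:
  fixes \<phi> \<psi> :: "'n::finite amplitudes"
  assumes "unitary_matrix M"
  shows "(\<Sum>n\<in>ball_sector K. cnj (second_quantization M \<phi> n) * second_quantization M \<psi> n) =
    (\<Sum>n\<in>ball_sector K. cnj (\<phi> n) * \<psi> n)"
proof -
  have "(\<Sum>n\<in>ball_sector K. f n) = (\<Sum>k\<le>K. \<Sum>n\<in>sector k. f n)" for f :: "'n amplitudes"
    unfolding ball_sector_def
    by (rule sum.UNION_disjoint) (auto simp: finite_sector, auto simp: sector_def)
  then show ?thesis
    by (simp only: sector_inner_second_quantization[OF assms])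
qed

lemma fock_linear:
  assumes "\<psi> \<in> fock" "\<phi> \<in> fock"
  shows "(\<lambda>n. c * \<psi> n + d * \<phi> n) \<in> fock"
proof -
  have "(\<lambda>n. 2 * (cmod c)\<^sup>2 * (cmod (\<psi> n))\<^sup>2 + 2 * (cmod d)\<^sup>2 * (cmod (\<phi> n))\<^sup>2) summable_on UNIV"
    using assms by (intro summable_on_add summable_on_cmult_right) (simp_all add: fock_def)
  moreover have "(cmod (c * x + d * y))\<^sup>2 \<le> 2 * (cmod c)\<^sup>2 * (cmod x)\<^sup>2 + 2 * (cmod d)\<^sup>2 * (cmod y)\<^sup>2" for x y
  proof -
    have "(cmod (c * x + d * y))\<^sup>2 \<le> (cmod (c * x) + cmod (d * y))\<^sup>2"
      by (simp add: norm_triangle_ineq power_mono)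
    also have "\<dots> \<le> 2 * (cmod (c * x))\<^sup>2 + 2 * (cmod (d * y))\<^sup>2"
      using sum_squares_bound[of "cmod (c * x)" "cmod (d * y)"] by (simp add: power2_sum)
    finally show ?thesis
      by (simp add: norm_mult power_mult_distrib)
  qed
  ultimately show ?thesis
    unfolding fock_def by (auto intro: summable_on_comparison_test)
qed

lemma fock_sum:
  assumes "\<And>j. j \<in> S \<Longrightarrow> \<psi> j \<in> fock"
  shows "(\<lambda>n. \<Sum>j\<in>S. c j * \<psi> j n) \<in> fock"
  using assms
proof (induction S rule: infinite_finite_induct)
  case (insert x S)
  then show ?case
    using fock_linear[of "\<psi> x" "\<lambda>n. \<Sum>j\<in>S. c j * \<psi> j n" "c x" 1] by simp
qed (simp_all add: fock_def)

lemma finite_support_fock: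
  assumes "finite S" and "\<And>n. n \<notin> S \<Longrightarrow> \<psi> n = 0"
  shows "\<psi> \<in> fock"
  unfolding fock_def mem_Collect_eq
  by (rule finite_nonzero_values_imp_summable_on, rule finite_subset[OF _ assms(1)]) (use assms(2) in auto)

lemma ket_fock: "ket m \<in> fock"
  by (rule finite_support_fock[of "{m}"]) (simp_all add: ket_def)

lemma fock_inner_summable:
  assumes "\<phi> \<in> fock" "\<psi> \<in> fock"
  shows "(\<lambda>n. cnj (\<phi> n) * \<psi> n) summable_on UNIV"
  by (rule abs_summable_summable, rule abs_summable_product)
    (use assms in \<open>simp_all add: fock_def norm_mult power2_eq_square\<close>)

text \<open>A finite partial sum is dominated by the sum over some \<open>ball_sector K\<close>,
  where the norm is preserved, and so by the squared norm of \<psi>.\<close>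

lemma second_quantization_fock:
  assumes "unitary_matrix M" "\<psi> \<in> fock"
  shows "second_quantization M \<psi> \<in> fock"
  unfolding fock_def mem_Collect_eq
proof (rule nonneg_bdd_above_summable_on)
  let ?U = "second_quantization M"
  have sm: "(\<lambda>n. (cmod (\<psi> n))\<^sup>2) summable_on UNIV"
    using assms(2) by (simp add: fock_def)
  show "bdd_above (sum (\<lambda>n. (cmod (?U \<psi> n))\<^sup>2) ` {F. F \<subseteq> UNIV \<and> finite F})"
  proof (rule bdd_aboveI2)
    fix F :: "(nat ^ 'a) set" assume "F \<in> {F. F \<subseteq> UNIV \<and> finite F}"
    then obtain K where "F \<subseteq> ball_sector K"
      using finite_subset_ball_sector by (metis (no_types, lifting) mem_Collect_eq order_refl)
    then have "(\<Sum>n\<in>F. (cmod (?U \<psi> n))\<^sup>2) \<le> (\<Sum>n\<in>ball_sector K. (cmod (?U \<psi> n))\<^sup>2)"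
      by (intro sum_mono2 finite_ball_sector) auto
    \<comment> \<open>The isometry is an identity between complex sums, so the real sum of squares
      is embedded first and the equality is read back afterwards.\<close>
    also have "complex_of_real \<dots> = (\<Sum>n\<in>ball_sector K. cnj (?U \<psi> n) * ?U \<psi> n)"
      by (simp add: complex_norm_square mult.commute del: of_real_power)
    then have "(\<Sum>n\<in>ball_sector K. (cmod (?U \<psi> n))\<^sup>2) = (\<Sum>n\<in>ball_sector K. (cmod (\<psi> n))\<^sup>2)"
      unfolding ball_sector_inner_second_quantization[OF assms(1)]
      by (simp add: complex_norm_square mult.commute flip: of_real_eq_iff[where 'a = complex] del: of_real_power)
    also have "\<dots> \<le> (\<Sum>\<^sub>\<infinity>n. (cmod (\<psi> n))\<^sup>2)"
      by (rule finite_sum_le_infsum[OF sm]) (auto simp: finite_ball_sector)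
    finally show "(\<Sum>n\<in>F. (cmod (?U \<psi> n))\<^sup>2) \<le> (\<Sum>\<^sub>\<infinity>n. (cmod (\<psi> n))\<^sup>2)" .
  qed
qed simp

lemma fock_inner_LIMSEQ:
  fixes \<phi> \<psi> :: "'n::finite amplitudes"
  assumes "\<phi> \<in> fock" "\<psi> \<in> fock"
  shows "(\<lambda>K. \<Sum>n\<in>ball_sector K. cnj (\<phi> n) * \<psi> n) \<longlonglongrightarrow> fock_inner \<phi> \<psi>"
proof -
  have "filterlim ball_sector (finite_subsets_at_top (UNIV :: (nat ^ 'n) set)) sequentially"
    unfolding filterlim_finite_subsets_at_top eventually_sequentially
    by (metis finite_ball_sector finite_subset_ball_sector subset_UNIV)
  moreover have "(sum (\<lambda>n. cnj (\<phi> n) * \<psi> n) \<longlongrightarrow> fock_inner \<phi> \<psi>) (finite_subsets_at_top UNIV)"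
    using has_sum_infsum[OF fock_inner_summable[OF assms]] by (simp add: has_sum_def fock_inner_def)
  ultimately show ?thesis
    by (rule filterlim_compose[rotated])
qed

text \<open>Both inner products are limits of the same sequence of sums over ball sectors.\<close>

lemma fock_inner_second_quantization:
  assumes "unitary_matrix M" "\<phi> \<in> fock" "\<psi> \<in> fock"
  shows "fock_inner (second_quantization M \<phi>) (second_quantization M \<psi>) = fock_inner \<phi> \<psi>"
  using fock_inner_LIMSEQ[OF assms(2,3)]
    fock_inner_LIMSEQ[OF second_quantization_fock[OF assms(1,2)] second_quantization_fock[OF assms(1,3)]]
  unfolding ball_sector_inner_second_quantization[OF assms(1)]
  by (metis LIMSEQ_unique)

text \<open>By multiplicativity, the second quantization of the adjoint matrix is a two-sided
  inverse; for an isometry such an inverse is the adjoint.\<close>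

lemma lop_transformation_second_quantization:
  assumes "unitary_matrix M"
  shows "lop_transformation M (second_quantization M)"
proof -
  let ?U = "second_quantization M"
  define M' where "M' = transpose (\<chi> i j. cnj (M $ i $ j))"
  let ?Ud = "second_quantization M'"
  have inv: "M' ** M = mat 1" "M ** M' = mat 1"
    using assms by (simp_all add: unitary_matrix_def Let_def M'_def)
  have "transpose (\<chi> i j. cnj (M' $ i $ j)) = M"
    by (simp add: M'_def transpose_def vec_eq_iff)
  then have M': "unitary_matrix M'"
    by (simp add: unitary_matrix_def inv)
  have cancel: "?Ud (?U \<psi>) = \<psi>" "?U (?Ud \<psi>) = \<psi>" for \<psi>
    by (simp_all add: second_quantization_mult inv second_quantization_one)
  have operator: "fock_operator (second_quantization N)" if "unitary_matrix N" for N :: "complex ^ 'a ^ 'a"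
    by (simp add: fock_operator_def second_quantization_fock that second_quantization_linear)
  have "fock_unitary ?U ?Ud"
    unfolding fock_unitary_def
  proof (intro conjI ballI operator assms M' cancel)
    fix \<phi> \<psi> :: "'a amplitudes" assume "\<phi> \<in> fock" "\<psi> \<in> fock"
    then show "fock_inner \<phi> (?U \<psi>) = fock_inner (?Ud \<phi>) \<psi>"
      using fock_inner_second_quantization[OF assms second_quantization_fock[OF M']] cancel by metis
  qed
  moreover have "?U \<psi> \<in> annih_domain i \<and>
      ?Ud (annih i (?U \<psi>)) = (\<lambda>n. \<Sum>j\<in>UNIV. M $ i $ j * annih j \<psi> n)"
    if "\<psi> \<in> (\<Inter>j. annih_domain j)" for i \<psi>
  proof -
    have "\<psi> \<in> fock" "annih j \<psi> \<in> fock" for j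
      using that by (auto simp: annih_domain_def)
    then have "second_quantization M \<psi> \<in> fock" "second_quantization M (mix_annih M i \<psi>) \<in> fock"
      by (auto simp: mix_annih_def intro!: second_quantization_fock[OF assms] fock_sum)
    then show ?thesis
      by (simp add: annih_domain_def annih_second_quantization cancel) (simp add: mix_annih_def)
  qed
  ultimately show ?thesis
    unfolding lop_transformation_def using second_quantization_vacuum by blast
qed

section \<open>Two-photon inputs\<close>

lemma fock_inner_ket: "fock_inner (ket m) \<psi> = \<psi> m"
proof -
  have "fock_inner (ket m) \<psi> = infsum (\<lambda>n. cnj (ket m n) * \<psi> n) {m}"
    unfolding fock_inner_def by (rule infsum_cong_neutral) (auto simp: ket_def)
  then show ?thesis
    by (simp add: ket_def)
qed

text \<open>The amplitude is the inner product of the vacuum with \<open>U \<psi>\<close>; moving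
  \<open>U\<close> across gives \<open>Ud (ket 0)\<close>, and the inverse \<open>Ud\<close> fixes
  the vacuum along with \<open>U\<close>.\<close>

lemma lop_transformation_vacuum_amplitude:
  assumes "lop_transformation M U" "\<psi> \<in> fock"
  shows "U \<psi> 0 = \<psi> 0"
proof -
  obtain Ud where Ud: "fock_unitary U Ud" and vac: "U (ket 0) = ket 0"
    using assms(1) by (auto simp: lop_transformation_def)
  then have "Ud (ket 0) = ket 0"
    using ket_fock[of 0] by (metis fock_unitary_def)
  moreover have "fock_inner (ket 0) (U \<psi>) = fock_inner (Ud (ket 0)) \<psi>"
    using Ud ket_fock assms(2) by (auto simp: fock_unitary_def)
  ultimately show ?thesis
    by (simp add: fock_inner_ket)
qed

lemma lop_transformation_annih:
  assumes "lop_transformation M U" "\<psi> \<in> (\<Inter>j. annih_domain j)"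
  shows "annih i (U \<psi>) = U (mix_annih M i \<psi>)"
proof -
  obtain Ud where Ud: "fock_unitary U Ud"
    and U: "U \<psi> \<in> annih_domain i" "Ud (annih i (U \<psi>)) = mix_annih M i \<psi>"
    using assms unfolding lop_transformation_def mix_annih_def by blast
  have "U (Ud (annih i (U \<psi>))) = annih i (U \<psi>)"
    using Ud U(1) by (auto simp: fock_unitary_def annih_domain_def)
  then show ?thesis
    by (simp add: U(2))
qed

lemma finite_support_annih:
  assumes "finite {n. \<psi> n \<noteq> 0}"
  shows "finite {n. annih i \<psi> n \<noteq> 0}"
proof (rule finite_subset)
  show "{n. annih i \<psi> n \<noteq> 0} \<subseteq> (\<lambda>n. n - axis i 1) ` {n. \<psi> n \<noteq> 0}"
  proof
    fix n assume "n \<in> {n. annih i \<psi> n \<noteq> 0}"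
    then have "n + axis i 1 \<in> {n. \<psi> n \<noteq> 0}"
      by (simp add: annih_def)
    moreover have "n = n + axis i 1 - axis i 1"
      by (simp add: vec_eq_iff)
    ultimately show "n \<in> (\<lambda>n. n - axis i 1) ` {n. \<psi> n \<noteq> 0}"
      by blast
  qed
qed (use assms in simp)

lemma finite_support_mix_annih:
  assumes "finite {n. \<psi> n \<noteq> 0}"
  shows "finite {n. mix_annih M i \<psi> n \<noteq> 0}"
proof (rule finite_subset)
  show "{n. mix_annih M i \<psi> n \<noteq> 0} \<subseteq> (\<Union>j. {n. annih j \<psi> n \<noteq> 0})"
    by (auto simp: mix_annih_def elim!: sum.not_neutral_contains_not_neutral)
qed (simp add: finite_support_annih[OF assms])

text \<open>For an arbitrary \<open>U\<close> the relation with the a_i is given on their common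
  domain. Finitely supported amplitudes lie in it and stay finitely supported under the b_i, so the
  uniqueness induction can be rerun on them.\<close>

lemma lop_transformation_finite_support:
  assumes "lop_transformation M U" "finite {n. \<psi> n \<noteq> 0}"
  shows "U \<psi> = second_quantization M \<psi>"
proof
  have fock: "\<psi> \<in> fock" if "finite {n. \<psi> n \<noteq> 0}" for \<psi> :: "'a amplitudes"
    using that by (rule finite_support_fock) simp
  fix m show "U \<psi> m = second_quantization M \<psi> m"
    using assms(2)
  proof (induction m arbitrary: \<psi> rule: occupation_induct)
    case zero
    then show ?case
      using lop_transformation_vacuum_amplitude[OF assms(1)] fock by (simp add: second_quantization_zero)
  next
    case (add m i)
    have "\<psi> \<in> (\<Inter>j. annih_domain j)"
      using add.prems by (auto simp: annih_domain_def intro!: fock finite_support_annih)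
    then have "annih i (U \<psi>) m = annih i (second_quantization M \<psi>) m"
      using add.IH[OF finite_support_mix_annih[OF add.prems]]
      by (simp add: lop_transformation_annih[OF assms(1)] annih_second_quantization)
    then show ?case
      by (simp add: annih_def del: of_nat_Suc)
  qed
qed

section \<open>Amplitudes of the image of a photon pair\<close>

lemma annih_ket_single: "annih i (ket (axis p 1)) = (\<lambda>n. if i = p then ket 0 n else 0)"
proof
  fix n :: "nat ^ 'a"
  have "n + axis i 1 = axis p 1 \<longleftrightarrow> i = p \<and> n = 0"
    by (auto simp: vec_eq_iff axis_def split: if_splits)
  then show "annih i (ket (axis p 1)) n = (if i = p then ket 0 n else 0)"
    by (auto simp: annih_def ket_def)
qed

lemma annih_ket_pair:
  assumes "p \<noteq> q"
  shows "annih i (ket (axis p 1 + axis q 1)) =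
    (\<lambda>n. if i = p then ket (axis q 1) n else if i = q then ket (axis p 1) n else 0)"
proof
  fix n :: "nat ^ 'a"
  have "n + axis i 1 = axis p 1 + axis q 1 \<longleftrightarrow> i = p \<and> n = axis q 1 \<or> i = q \<and> n = axis p 1"
  proof
    assume *: "n + axis i 1 = axis p 1 + axis q 1"
    then have "(n + axis i 1) $ i = (axis p 1 + axis q 1) $ i"
      by simp
    then have "i = p \<or> i = q"
      by (auto simp: axis_def split: if_splits)
    with * show "i = p \<and> n = axis q 1 \<or> i = q \<and> n = axis p 1"
      by (metis add.commute add_right_imp_eq)
  qed (auto simp: add.commute)
  then show "annih i (ket (axis p 1 + axis q 1)) n =
      (if i = p then ket (axis q 1) n else if i = q then ket (axis p 1) n else 0)"
    using assms by (auto simp: annih_def ket_def axis_eq_axis) (simp_all add: axis_def)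
qed

lemma mix_annih_ket_single: "mix_annih M i (ket (axis p 1)) = (\<lambda>n. M $ i $ p * ket 0 n)"
  unfolding mix_annih_def annih_ket_single by (simp add: if_distrib cong: if_cong)

lemma mix_annih_ket_pair:
  assumes "p \<noteq> q"
  shows "mix_annih M i (ket (axis p 1 + axis q 1)) =
    (\<lambda>n. M $ i $ p * ket (axis q 1) n + M $ i $ q * ket (axis p 1) n)"
proof
  fix n
  have "M $ i $ j * annih j (ket (axis p 1 + axis q 1)) n =
      (if j = p then M $ i $ p * ket (axis q 1) n else 0) +
      (if j = q then M $ i $ q * ket (axis p 1) n else 0)" for j
    unfolding annih_ket_pair[OF assms] using assms by auto
  then show "mix_annih M i (ket (axis p 1 + axis q 1)) n =
      M $ i $ p * ket (axis q 1) n + M $ i $ q * ket (axis p 1) n"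
    by (simp add: mix_annih_def sum.distrib)
qed

text \<open>Two mixed annihilations reduce the pair to a multiple of the vacuum, which is fixed. The
  coefficient is the permanent of the submatrix of \<open>M\<close> with rows i, j and columns p,
  q.\<close>

lemma annih_annih_second_quantization_pair:
  assumes "p \<noteq> q"
  shows "annih i (annih j (second_quantization M (ket (axis p 1 + axis q 1)))) =
    (\<lambda>n. (M $ j $ p * M $ i $ q + M $ j $ q * M $ i $ p) * ket 0 n)"
proof -
  let ?c = "M $ j $ p * M $ i $ q + M $ j $ q * M $ i $ p"
  have "annih i (annih j (second_quantization M (ket (axis p 1 + axis q 1)))) =
      second_quantization M (\<lambda>n. ?c * ket 0 n + 0 * ket 0 n)"
    unfolding annih_second_quantization mix_annih_ket_pair[OF assms] mix_annih_linear
      mix_annih_ket_single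
    by (simp add: algebra_simps)
  also have "\<dots> = (\<lambda>n. ?c * ket 0 n)"
    unfolding second_quantization_linear by (simp add: second_quantization_vacuum)
  finally show ?thesis .
qed

text \<open>Evaluating the double annihilation at 0 gives the amplitude times the two prefactors,
  whose product is \<open>sqrt 2\<close> if both photons sit in one mode and 1 otherwise.\<close>

lemma second_quantization_pair_amplitude:
  assumes "p \<noteq> q"
  shows "second_quantization M (ket (axis p 1 + axis q 1)) (axis i 1 + axis j 1) =
    (M $ j $ p * M $ i $ q + M $ j $ q * M $ i $ p) / (if i = j then complex_of_real (sqrt 2) else 1)"
  using fun_cong[OF annih_annih_second_quantization_pair[OF assms, of i j M], of 0]
  by (auto simp: annih_def ket_def axis_def field_simps)

text \<open>With no photon or one photon, the amplitude reduces to a vacuum amplitude that vanishes.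
  With at least two, lowering twice leaves some \<open>m\<close>, nonzero outside sector 2, where
  the multiple of the vacuum vanishes.\<close>

lemma second_quantization_pair_support:
  assumes "p \<noteq> q" "n \<notin> sector 2"
  shows "second_quantization M (ket (axis p 1 + axis q 1)) n = 0"
proof -
  let ?\<Phi> = "second_quantization M (ket (axis p 1 + axis q 1))"
  have split: "m = 0 \<or> (\<exists>m' i. m = m' + axis i 1)" for m :: "nat ^ 'a"
    by (induction m rule: occupation_induct) auto
  have axis0: "axis k (1::nat) \<noteq> 0" for k :: 'a
    by (simp add: axis_eq_0_iff)
  have pair0: "axis p 1 + axis q (1::nat) \<noteq> 0"
    by (auto simp: vec_eq_iff axis_def intro!: exI[of _ p])
  consider "n = 0" | i where "n = axis i 1" | m i j where "n = m + axis i 1 + axis j 1"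
    using split[of n] split by (metis add_0)
  then show ?thesis
  proof cases
    case 1
    then show ?thesis
      using pair0 by (simp add: second_quantization_zero ket_def)
  next
    case 2
    have "annih i ?\<Phi> 0 = mix_annih M i (ket (axis p 1 + axis q 1)) 0"
      by (simp add: annih_second_quantization second_quantization_zero)
    also have "\<dots> = 0"
      unfolding mix_annih_ket_pair[OF assms(1)] using axis0[of p] axis0[of q] by (simp add: ket_def)
    finally show ?thesis
      by (simp add: 2 annih_def)
  next
    case 3
    have "(\<Sum>k\<in>UNIV. n $ k) = Suc (Suc (\<Sum>k\<in>UNIV. m $ k))"
      unfolding 3 by (simp only: sum_add_axis)
    then have "m \<noteq> 0"
      using assms(2) by (auto simp: sector_def)
    then have "annih i (annih j ?\<Phi>) m = 0"
      unfolding annih_annih_second_quantization_pair[OF assms(1)] by (simp add: ket_def)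
    then show ?thesis
      by (simp add: 3 annih_def del: of_nat_Suc)
  qed
qed

section \<open>Factorisation of quadratic forms and unitary dilation\<close>

lemma binary_quadratic_form_factors:
  fixes a b c :: complex
  obtains x1 x2 y1 y2 where "x1 * y1 = a" "x1 * y2 + x2 * y1 = b" "x2 * y2 = c"
proof (cases "a = 0")
  case True
  \<comment> \<open>The form b X Y + c Y^2 is Y (b X + c Y).\<close>
  then show ?thesis
    using that[of 0 b c 1] by simp
next
  case False
  \<comment> \<open>With a root d of the discriminant, the form splits as (X + (b - d)/(2a) Y) (a X
    + (b + d)/2 Y).\<close>
  define d where "d = csqrt (b\<^sup>2 - 4 * a * c)"
  have d: "d\<^sup>2 = b\<^sup>2 - 4 * a * c"
    by (simp add: d_def)
  have "(b - d) / (2 * a) * ((b + d) / 2) = (b\<^sup>2 - d\<^sup>2) / (4 * a)"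
    by (simp add: power2_eq_square algebra_simps)
  also have "\<dots> = c"
    using False by (simp add: d)
  finally have "(b - d) / (2 * a) * ((b + d) / 2) = c" .
  then show ?thesis
    using that[of 1 a "(b + d) / 2" "(b - d) / (2 * a)"] False by (simp add: field_simps)
qed

text \<open>The third column is the conjugated cross product of the first two, which is orthogonal
  to both.\<close>

lemma unitary_completion_3:
  fixes u1 u2 u3 v1 v2 v3 :: complex
  assumes u: "cnj u1 * u1 + cnj u2 * u2 + cnj u3 * u3 = 1"
    and v: "cnj v1 * v1 + cnj v2 * v2 + cnj v3 * v3 = 1"
    and uv: "cnj u1 * v1 + cnj u2 * v2 + cnj u3 * v3 = 0"
  obtains M :: "complex ^ 3 ^ 3" where "unitary_matrix M"
    "M $ 1 $ 1 = u1" "M $ 2 $ 1 = u2" "M $ 3 $ 1 = u3"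
    "M $ 1 $ 2 = v1" "M $ 2 $ 2 = v2" "M $ 3 $ 2 = v3"
proof -
  define z1 z2 z3 where "z1 = cnj (u2 * v3 - u3 * v2)" and "z2 = cnj (u3 * v1 - u1 * v3)"
    and "z3 = cnj (u1 * v2 - u2 * v1)"
  define M :: "complex ^ 3 ^ 3" where
    "M = vector [vector [u1, v1, z1], vector [u2, v2, z2], vector [u3, v3, z3]]"
  let ?Md = "transpose (\<chi> i j. cnj (M $ i $ j))"
  have vu: "cnj v1 * u1 + cnj v2 * u2 + cnj v3 * u3 = 0"
    using arg_cong[OF uv, of cnj] by (simp add: mult.commute)
  \<comment> \<open>Lagrange's identity for the cross product.\<close>
  have "cnj z1 * z1 + cnj z2 * z2 + cnj z3 * z3 =
      (cnj u1 * u1 + cnj u2 * u2 + cnj u3 * u3) * (cnj v1 * v1 + cnj v2 * v2 + cnj v3 * v3) -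
      (cnj u1 * v1 + cnj u2 * v2 + cnj u3 * v3) * (cnj v1 * u1 + cnj v2 * u2 + cnj v3 * u3)"
    by (simp add: z1_def z2_def z3_def algebra_simps)
  then have zz: "cnj z1 * z1 + cnj z2 * z2 + cnj z3 * z3 = 1"
    by (simp add: u v uv)
  have uz: "cnj u1 * z1 + cnj u2 * z2 + cnj u3 * z3 = 0" "cnj v1 * z1 + cnj v2 * z2 + cnj v3 * z3 = 0"
    "cnj z1 * u1 + cnj z2 * u2 + cnj z3 * u3 = 0" "cnj z1 * v1 + cnj z2 * v2 + cnj z3 * v3 = 0"
    by (simp_all add: z1_def z2_def z3_def algebra_simps)
  have "?Md ** M = mat 1"
    by (simp add: vec_eq_iff forall_3 matrix_matrix_mult_def transpose_def mat_def sum_3 M_def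
        u v uv vu zz uz)
  then have "unitary_matrix M"
    by (simp add: unitary_matrix_def Let_def matrix_left_right_inverse)
  then show ?thesis
    by (rule that) (simp_all add: M_def)
qed

text \<open>
  A \<open>2 \<times> 2\<close> matrix with columns of norm \<open>r\<close> and column inner product \<open>r\<^sup>2 p\<close> extends to a unitary
  with one more mode exactly when its largest singular value is 1, i.e. \<open>r\<^sup>2 (1 + |p|) = 1\<close>.
\<close>

lemma unit_columns_dilate:
  fixes x1 x2 y1 y2 :: complex
  assumes x: "(cmod x1)\<^sup>2 + (cmod x2)\<^sup>2 = 1" and y: "(cmod y1)\<^sup>2 + (cmod y2)\<^sup>2 = 1"
  obtains r :: real and M :: "complex ^ 3 ^ 3" where "r > 0" "unitary_matrix M"
    "M $ 1 $ 1 = r * x1" "M $ 2 $ 1 = r * x2" "M $ 1 $ 2 = r * y1" "M $ 2 $ 2 = r * y2"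
proof -
  define p where "p = cnj x1 * y1 + cnj x2 * y2"
  define r where "r = 1 / sqrt (1 + cmod p)"
  have pos: "1 + cmod p > 0"
    by (simp add: add_pos_nonneg)
  then have r: "r > 0"
    by (simp add: r_def)
  have r2: "r\<^sup>2 = 1 / (1 + cmod p)"
    using pos by (simp add: r_def power_divide)
  \<comment> \<open>The third row receives \<open>w\<close> and \<open>- w * sgn p\<close>: with w^2
    = r^2 |p| both columns get norm 1, and the new term -w^2 \<open>sgn p\<close> cancels the inner
    product r^2 p.\<close>
  define w where "w = r * sqrt (cmod p)"
  have w2: "r\<^sup>2 + w\<^sup>2 = 1" "w\<^sup>2 = r\<^sup>2 * cmod p"
    using pos by (simp_all add: w_def power_mult_distrib r2 flip: add_divide_distrib)
  have csq: "cnj z * z = complex_of_real ((cmod z)\<^sup>2)" for z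
    by (simp add: complex_norm_square mult.commute del: of_real_power)
  let ?w' = "- (of_real w * sgn p)"
  have "cmod ?w' = w"
    using r by (cases "p = 0") (simp_all add: norm_mult norm_sgn w_def)
  then have "cnj (r * x1) * (r * x1) + cnj (r * x2) * (r * x2) + cnj w * w = 1"
    "cnj (r * y1) * (r * y1) + cnj (r * y2) * (r * y2) + cnj ?w' * ?w' = 1"
    using w2(1) x y
    by (simp_all only: csq norm_mult norm_of_real power_mult_distrib power2_abs
        flip: of_real_add distrib_left) simp_all
  moreover have "cnj (r * x1) * (r * y1) + cnj (r * x2) * (r * y2) + cnj w * ?w' = 0"
  proof -
    have "cnj (r * x1) * (r * y1) + cnj (r * x2) * (r * y2) + cnj w * ?w' =
        of_real (r\<^sup>2) * p - of_real (w\<^sup>2) * sgn p"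
      by (simp add: p_def power2_eq_square algebra_simps)
    also have "\<dots> = of_real (r\<^sup>2) * (p - of_real (cmod p) * sgn p)"
      by (simp add: w2(2) algebra_simps)
    also have "p - of_real (cmod p) * sgn p = 0"
      by (cases "p = 0") (simp_all add: complex_sgn_def scaleR_conv_of_real field_simps)
    finally show ?thesis
      by simp
  qed
  ultimately obtain M :: "complex ^ 3 ^ 3" where "unitary_matrix M"
    "M $ 1 $ 1 = r * x1" "M $ 2 $ 1 = r * x2" "M $ 1 $ 2 = r * y1" "M $ 2 $ 2 = r * y2"
    by (rule unitary_completion_3)
  with r that show ?thesis
    by blast
qed

text \<open>The target state is the form A/sqrt 2 X^2 + B X Y + C/sqrt 2 Y^2 in the creation
  operators X, Y of modes 1, 2. Its linear factors are normalised by \<open>k\<close> and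
  \<open>l\<close> and scaled by \<open>r\<close> in the dilation, so s = r^2/(k l).\<close>

lemma two_photon_unitary:
  fixes A B C :: complex
  assumes "A \<noteq> 0 \<or> B \<noteq> 0 \<or> C \<noteq> 0"
  obtains M :: "complex ^ 3 ^ 3" and s :: complex where "unitary_matrix M" "s \<noteq> 0"
    "of_real (sqrt 2) * M $ 1 $ 1 * M $ 1 $ 2 = s * A"
    "M $ 1 $ 1 * M $ 2 $ 2 + M $ 2 $ 1 * M $ 1 $ 2 = s * B"
    "of_real (sqrt 2) * M $ 2 $ 1 * M $ 2 $ 2 = s * C"
proof -
  obtain x1 x2 y1 y2 where xy: "x1 * y1 = A / of_real (sqrt 2)" "x1 * y2 + x2 * y1 = B"
    "x2 * y2 = C / of_real (sqrt 2)"
    by (rule binary_quadratic_form_factors)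
  define k l where "k = sqrt ((cmod x1)\<^sup>2 + (cmod x2)\<^sup>2)" and "l = sqrt ((cmod y1)\<^sup>2 + (cmod y2)\<^sup>2)"
  have "x1 \<noteq> 0 \<or> x2 \<noteq> 0" "y1 \<noteq> 0 \<or> y2 \<noteq> 0"
    using xy assms by auto
  then have kl: "k \<noteq> 0" "l \<noteq> 0"
    by (auto simp: k_def l_def add_nonneg_eq_0_iff)
  have k2: "k\<^sup>2 = (cmod x1)\<^sup>2 + (cmod x2)\<^sup>2" "l\<^sup>2 = (cmod y1)\<^sup>2 + (cmod y2)\<^sup>2"
    by (simp_all add: k_def l_def)
  have "(cmod (x1 / k))\<^sup>2 + (cmod (x2 / k))\<^sup>2 = 1" "(cmod (y1 / l))\<^sup>2 + (cmod (y2 / l))\<^sup>2 = 1"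
    using kl by (simp_all add: norm_divide power_divide flip: add_divide_distrib k2)
  then obtain r and M :: "complex ^ 3 ^ 3" where r: "r > 0" and M: "unitary_matrix M"
    "M $ 1 $ 1 = of_real r * (x1 / of_real k)" "M $ 2 $ 1 = of_real r * (x2 / of_real k)"
    "M $ 1 $ 2 = of_real r * (y1 / of_real l)" "M $ 2 $ 2 = of_real r * (y2 / of_real l)"
    by (rule unit_columns_dilate)
  let ?s = "complex_of_real (r\<^sup>2 / (k * l))"
  have "of_real (sqrt 2) * M $ 1 $ 1 * M $ 1 $ 2 = ?s * (of_real (sqrt 2) * (x1 * y1))"
    "M $ 1 $ 1 * M $ 2 $ 2 + M $ 2 $ 1 * M $ 1 $ 2 = ?s * (x1 * y2 + x2 * y1)"
    "of_real (sqrt 2) * M $ 2 $ 1 * M $ 2 $ 2 = ?s * (of_real (sqrt 2) * (x2 * y2))"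
    unfolding M by (simp_all add: power2_eq_square algebra_simps add_divide_distrib)
  then show ?thesis
    using r kl by (intro that[OF M(1), of ?s]) (simp_all add: xy)
qed

theorem mainTheorem1:
  fixes A B C :: complex and \<phi> :: "2 amplitudes"
  assumes "(cmod A)\<^sup>2 + (cmod B)\<^sup>2 + (cmod C)\<^sup>2 = 1"
    and "\<phi> = (\<lambda>n. A * ket (vector [2, 0]) n + B * ket (vector [1, 1]) n + C * ket (vector [0, 2]) n)"
  shows "\<exists>M :: complex ^ 3 ^ 3. unitary_matrix M \<and>
    (\<exists>U. lop_transformation M U) \<and>
    (\<forall>U. lop_transformation M U \<longrightarrow>
      (\<exists>\<phi>0\<in>fock. \<exists>\<phi>1\<in>fock. \<exists>\<phi>2\<in>fock.
         U (tensor_2_1 (ket (vector [1, 1])) (ket (vector [0]))) =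
           (\<lambda>n. tensor_2_1 \<phi>0 (ket (vector [0])) n
              + tensor_2_1 \<phi>1 (ket (vector [1])) n
              + tensor_2_1 \<phi>2 (ket (vector [2])) n) \<and>
         fock_inner \<phi>0 \<phi>0 \<noteq> 0 \<and>
         (\<exists>c. c \<noteq> 0 \<and> \<phi>0 = (\<lambda>n. c * \<phi> n))))"
proof -
  have "A \<noteq> 0 \<or> B \<noteq> 0 \<or> C \<noteq> 0"
    using assms(1) by auto
  then obtain M :: "complex ^ 3 ^ 3" and s where M: "unitary_matrix M" and s: "s \<noteq> 0"
    and A: "of_real (sqrt 2) * M $ 1 $ 1 * M $ 1 $ 2 = s * A"
    and B: "M $ 1 $ 1 * M $ 2 $ 2 + M $ 2 $ 1 * M $ 1 $ 2 = s * B"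
    and C: "of_real (sqrt 2) * M $ 2 $ 1 * M $ 2 $ 2 = s * C"
    by (rule two_photon_unitary)
  have ne: "(1 :: 3) \<noteq> 2"
    by simp
  have eqs: "(vector [2, 0, 0] :: nat ^ 3) = axis 1 1 + axis 1 1"
    "(vector [1, 1, 0] :: nat ^ 3) = axis 1 1 + axis 2 1"
    "(vector [0, 2, 0] :: nat ^ 3) = axis 2 1 + axis 2 1"
    by (simp_all add: vec_eq_iff forall_3 axis_def)
  define \<Phi> :: "3 amplitudes" where "\<Phi> = second_quantization M (ket (axis 1 1 + axis 2 1))"
  have \<Phi>_support: "\<Phi> n = 0" if "n $ 1 + n $ 2 + n $ 3 \<noteq> 2" for n
    unfolding \<Phi>_def using that by (intro second_quantization_pair_support[OF ne]) (simp add: sector_def sum_3)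
  \<comment> \<open>For two photons in one mode the two terms of the permanent coincide, and the
    division by \<open>sqrt 2\<close> turns the factor 2 into \<open>sqrt 2\<close>.\<close>
  have double: "2 * z / complex_of_real (sqrt 2) = of_real (sqrt 2) * z" for z
    by (simp add: field_simps flip: of_real_mult)
  have \<Phi>_A: "\<Phi> (vector [2, 0, 0]) = s * A"
    unfolding \<Phi>_def eqs second_quantization_pair_amplitude[OF ne]
    using double[of "M $ 1 $ 1 * M $ 1 $ 2"] A by (simp add: mult.commute mult.left_commute)
  have \<Phi>_B: "\<Phi> (vector [1, 1, 0]) = s * B"
    unfolding \<Phi>_def eqs second_quantization_pair_amplitude[OF ne]
    using B by (simp add: mult.commute add.commute)
  have \<Phi>_C: "\<Phi> (vector [0, 2, 0]) = s * C"
    unfolding \<Phi>_def eqs second_quantization_pair_amplitude[OF ne]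
    using double[of "M $ 2 $ 1 * M $ 2 $ 2"] C by (simp add: mult.commute mult.left_commute)
  \<comment> \<open>The component with \<open>k\<close> photons in mode 3, as an amplitude on modes
    1 and 2.\<close>
  define part where "part k n = \<Phi> (vector [n $ 1, n $ 2, k])" for k and n :: "nat ^ 2"
  have part_fock: "part k \<in> fock" for k
  proof (rule finite_support_fock)
    show "finite (\<Union>j\<le>2. sector j :: (nat ^ 2) set)"
      by (simp add: finite_sector)
    show "part k n = 0" if "n \<notin> (\<Union>j\<le>2. sector j)" for n
      using that unfolding part_def by (intro \<Phi>_support) (auto simp: sector_def sum_2)
  qed
  have tensor: "tensor_2_1 (part k) (ket (vector [k])) n = (if n $ 3 = k then \<Phi> n else 0)" for k n
  proof -
    have "vector [n $ 1, n $ 2, n $ 3] = n"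
      by (simp add: vec_eq_iff forall_3)
    moreover have "(vector [n $ 3] :: nat ^ 1) = vector [k] \<longleftrightarrow> n $ 3 = k"
      by (simp add: vec_eq_iff)
    ultimately show ?thesis
      by (auto simp: tensor_2_1_def part_def ket_def)
  qed
  have decomposition: "\<Phi> = (\<lambda>n. tensor_2_1 (part 0) (ket (vector [0])) n
      + tensor_2_1 (part 1) (ket (vector [1])) n + tensor_2_1 (part 2) (ket (vector [2])) n)"
  proof
    fix n
    \<comment> \<open>The terms select 0, 1 and 2 photons in mode 3; beyond that \<Phi> vanishes,
      since it carries two photons in all.\<close>
    show "\<Phi> n = tensor_2_1 (part 0) (ket (vector [0])) n
      + tensor_2_1 (part 1) (ket (vector [1])) n + tensor_2_1 (part 2) (ket (vector [2])) n"
      unfolding tensor using \<Phi>_support[of n] by (cases "n $ 3 \<le> 2") auto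
  qed
  have vector_2_eq: "n = vector [a, b] \<longleftrightarrow> n $ 1 = a \<and> n $ 2 = b" for n :: "nat ^ 2" and a b
    by (simp add: vec_eq_iff forall_2)
  have part0: "part 0 = (\<lambda>n. s * \<phi> n)"
  proof
    fix n :: "nat ^ 2"
    consider "n = vector [2, 0]" | "n = vector [1, 1]" | "n = vector [0, 2]" | "n $ 1 + n $ 2 \<noteq> 2"
      unfolding vector_2_eq by arith
    then show "part 0 n = s * \<phi> n"
    proof cases
      case 4
      then have "part 0 n = 0"
        unfolding part_def by (intro \<Phi>_support) simp
      with 4 show ?thesis
        by (auto simp: assms(2) ket_def vector_2_eq)
    qed (use \<Phi>_A \<Phi>_B \<Phi>_C in \<open>simp_all add: part_def assms(2) ket_def vector_2_eq\<close>)
  qed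
  \<comment> \<open>The success probability is |s|^2, by the normalisation of A, B, C.\<close>
  have norm: "fock_inner (part 0) (part 0) \<noteq> 0"
  proof -
    let ?S = "{vector [2, 0], vector [1, 1], vector [0, 2]} :: (nat ^ 2) set"
    have "fock_inner (part 0) (part 0) = infsum (\<lambda>n. cnj (part 0 n) * part 0 n) ?S"
      unfolding fock_inner_def
      by (rule infsum_cong_neutral) (auto simp: part0 assms(2) ket_def)
    also have "\<dots> = cnj (s * A) * (s * A) + cnj (s * B) * (s * B) + cnj (s * C) * (s * C)"
      by (simp add: part0 assms(2) ket_def vector_2_eq)
    also have "\<dots> = of_real ((cmod s)\<^sup>2 * ((cmod A)\<^sup>2 + (cmod B)\<^sup>2 + (cmod C)\<^sup>2))"
      by (simp add: complex_norm_square algebra_simps del: of_real_power)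
    finally show ?thesis
      using s by (simp add: assms(1))
  qed
  have input: "tensor_2_1 (ket (vector [1, 1])) (ket (vector [0])) = ket (axis 1 1 + axis 2 1)"
  proof
    fix n :: "nat ^ 3"
    show "tensor_2_1 (ket (vector [1, 1])) (ket (vector [0])) n = ket (axis 1 1 + axis 2 1) n"
      unfolding eqs(2)[symmetric]
      by (auto simp: tensor_2_1_def ket_def vec_eq_iff forall_2 forall_3)
  qed
  \<comment> \<open>The input is a single number state, hence finitely supported, so every
    transformation associated with \<open>M\<close> sends it to the same \<Phi>.\<close>
  have image: "U (ket (axis 1 1 + axis 2 1)) = \<Phi>" if "lop_transformation M U" for U
    unfolding \<Phi>_def by (rule lop_transformation_finite_support[OF that]) (simp add: ket_def)
  have "\<exists>\<phi>0\<in>fock. \<exists>\<phi>1\<in>fock. \<exists>\<phi>2\<in>fock.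
      U (tensor_2_1 (ket (vector [1, 1])) (ket (vector [0]))) =
        (\<lambda>n. tensor_2_1 \<phi>0 (ket (vector [0])) n + tensor_2_1 \<phi>1 (ket (vector [1])) n
          + tensor_2_1 \<phi>2 (ket (vector [2])) n) \<and>
      fock_inner \<phi>0 \<phi>0 \<noteq> 0 \<and> (\<exists>c. c \<noteq> 0 \<and> \<phi>0 = (\<lambda>n. c * \<phi> n))"
    if "lop_transformation M U" for U
  proof (intro bexI conjI)
    show "U (tensor_2_1 (ket (vector [1, 1])) (ket (vector [0]))) =
        (\<lambda>n. tensor_2_1 (part 0) (ket (vector [0])) n + tensor_2_1 (part 1) (ket (vector [1])) n
          + tensor_2_1 (part 2) (ket (vector [2])) n)"
      unfolding input image[OF that] by (rule decomposition)
    show "\<exists>c. c \<noteq> 0 \<and> part 0 = (\<lambda>n. c * \<phi> n)"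
      using s part0 by blast
  qed (rule norm part_fock)+
  then show ?thesis
    using M lop_transformation_second_quantization[OF M] by blast
qed

end
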